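(* Let $k\in\{2,3,4,5\}$, let $f\in C^k([0,1])$ be real-valued, and let $\gamma_k,\Gamma_k$ be real numbers such that $\gamma_k\le f^{(k)}(x)\le\Gamma_k$ for all $x\in[0,1]$. Let $S_{k-1}=f^{(k-1)}(1)-f^{(k-1)}(0)$. Let $R_k(f)=\int_0^1T_k(x)f^{(k)}(x)\,dx$, which is the error in $$\int_0^1 f(x)\,dx=\frac{7f(0)+16f(\frac12)+7f(1)}{30}-\frac{f'(1)-f'(0)}{60}+R_k(f).$$ Then $$|R_k(f)|\le\frac{\Gamma_k-\gamma_k}{2}C_k,\qquad |R_k(f)|\le(S_{k-1}-\gamma_k)B_k,\qquad |R_k(f)|\le(\Gamma_k-S_{k-1})B_k,$$ where $$C_2=\frac{19\sqrt{19}}{10125},\quad C_3=\frac{253}{360000},\quad C_4=\frac1{14580},\quad C_5=\frac1{115200},$$ $$B_2=\frac1{40},\quad B_3=\frac7{20250}+\frac{19\sqrt{19}}{81000},\quad B_4=\frac1{5760},\quad B_5=\frac1{58320}.$$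
   Context: The kernels are $T_k(x)=(-1)^kP_k(x)$ for $x\in[0,\frac12)$ and $T_k(x)=(-1)^kQ_k(x)$ for $x\in[\frac12,1]$, where $P_2(x)=\frac12x^2-\frac7{30}x+\frac1{60}$, $Q_2(x)=\frac12x^2-\frac{23}{30}x+\frac{17}{60}$; $P_3(x)=\frac1{3!}x(x-\frac15)(x-\frac12)$, $Q_3(x)=\frac1{3!}(x-1)(x-\frac12)(x-\frac45)$; $P_4(x)=\frac1{4!}x^2(x-\frac13)(x-\frac35)$, $Q_4(x)=\frac1{4!}(x-1)^2(x-\frac23)(x-\frac25)$; $P_5(x)=\frac1{5!}x^3(x-\frac12)(x-\frac23)$, $Q_5(x)=\frac1{5!}(x-1)^3(x-\frac12)(x-\frac13)$. *)

theory Defs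
  imports "HOL-Analysis.Analysis"
begin

text \<open>
  Derivatives are taken within the set \<open>S\<close>, so for \<open>S = {0..1}\<close> they are one-sided at the
  end points and do not depend on the values of \<open>f\<close> outside \<open>[0,1]\<close>.
\<close>

primrec nth_deriv_within :: "real set \<Rightarrow> nat \<Rightarrow> (real \<Rightarrow> real) \<Rightarrow> real \<Rightarrow> real" where
  "nth_deriv_within S 0 f = f"
| "nth_deriv_within S (Suc n) f = (\<lambda>x. vector_derivative (nth_deriv_within S n f) (at x within S))"

definition C_diff_on :: "nat \<Rightarrow> (real \<Rightarrow> real) \<Rightarrow> real set \<Rightarrow> bool" where
  "C_diff_on k f S \<longleftrightarrow>
     (\<forall>i<k. nth_deriv_within S i f differentiable_on S) \<and> continuous_on S (nth_deriv_within S k f)"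

abbreviation D01 :: "nat \<Rightarrow> (real \<Rightarrow> real) \<Rightarrow> real \<Rightarrow> real" where
  "D01 \<equiv> nth_deriv_within {0..1}"

text \<open>
  The polynomials and constants below are only meaningful for \<open>k \<in> {2,3,4,5}\<close>; the value \<open>0\<close> for
  other indices is a dummy.
\<close>

definition P :: "nat \<Rightarrow> real \<Rightarrow> real" where
  "P k x =
    (if k = 2 then 1/2 * x^2 - 7/30 * x + 1/60
     else if k = 3 then 1 / fact 3 * x * (x - 1/5) * (x - 1/2)
     else if k = 4 then 1 / fact 4 * x^2 * (x - 1/3) * (x - 3/5)
     else if k = 5 then 1 / fact 5 * x^3 * (x - 1/2) * (x - 2/3)
     else 0)"

definition Q :: "nat \<Rightarrow> real \<Rightarrow> real" where
  "Q k x =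
    (if k = 2 then 1/2 * x^2 - 23/30 * x + 17/60
     else if k = 3 then 1 / fact 3 * (x - 1) * (x - 1/2) * (x - 4/5)
     else if k = 4 then 1 / fact 4 * (x - 1)^2 * (x - 2/3) * (x - 2/5)
     else if k = 5 then 1 / fact 5 * (x - 1)^3 * (x - 1/2) * (x - 1/3)
     else 0)"

definition T :: "nat \<Rightarrow> real \<Rightarrow> real" where
  "T k x = (if x < 1/2 then (-1)^k * P k x else (-1)^k * Q k x)"

definition R :: "nat \<Rightarrow> (real \<Rightarrow> real) \<Rightarrow> real" where
  "R k f = integral {0..1} (\<lambda>x. T k x * D01 k f x)"

definition S :: "nat \<Rightarrow> (real \<Rightarrow> real) \<Rightarrow> real" where
  "S j f = D01 j f 1 - D01 j f 0"

definition C_const :: "nat \<Rightarrow> real" where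
  "C_const k =
    (if k = 2 then 19 * sqrt 19 / 10125
     else if k = 3 then 253 / 360000
     else if k = 4 then 1 / 14580
     else if k = 5 then 1 / 115200
     else 0)"

definition B_const :: "nat \<Rightarrow> real" where
  "B_const k =
    (if k = 2 then 1 / 40
     else if k = 3 then 7 / 20250 + 19 * sqrt 19 / 81000
     else if k = 4 then 1 / 5760
     else if k = 5 then 1 / 58320
     else 0)"

end

theory Submission
  imports Defs
begin

text \<open>
  The kernels are piecewise polynomial antiderivatives of each other: \<open>P (k + 1)\<close> and
  \<open>Q (k + 1)\<close> have the derivatives \<open>P k\<close> and \<open>Q k\<close>. The two pieces agree at \<open>1/2\<close>, and for
  \<open>k + 1 \<ge> 3\<close> the first vanishes at \<open>0\<close> and the second at \<open>1\<close>. Hence integration by parts on both halves of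
  \<open>[0,1]\<close> produces no boundary terms and gives \<open>R (k + 1) f = R k f\<close> (\<open>R_Suc\<close>), so that
  the error formula is needed only for \<open>k = 2\<close> (\<open>R_2\<close>). There two more integrations by parts
  lead down to the piecewise constant kernel \<open>1\<close>: the values of \<open>P 2\<close> and \<open>Q 2\<close> at the end
  points are, up to sign, the weights of \<open>f' 0\<close> and \<open>f' 1\<close>, and the end values and the jump at \<open>1/2\<close> of
  the linear kernels \<open>x - 7/30\<close> and \<open>x - 23/30\<close> are the weights of \<open>f 0\<close>, \<open>f 1\<close> and
  \<open>f (1/2)\<close>.

  For the inequalities, each kernel has mean zero, so
  \<open>R k f = \<integral> T k \<cdot> (f\<^sup>(\<^sup>k\<^sup>) - c)\<close> for every constant \<open>c\<close>. The midpoint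
  \<open>c = (\<gamma> + \<Gamma>) / 2\<close> gives a bound by the \<open>L\<^sup>1\<close> norm of \<open>T k\<close>. The choices \<open>c = \<gamma>\<close> and
  \<open>c = \<Gamma>\<close> give a factor of constant sign, whose integral is known exactly because
  \<open>\<integral> f\<^sup>(\<^sup>k\<^sup>) = S (k - 1) f\<close>, and hence bounds by the supremum norm of \<open>T k\<close>
  (\<open>mean_zero_kernel_bounds\<close>). The constants \<open>C_const k\<close> and \<open>B_const k\<close> are exactly these
  two norms. By the symmetry \<open>Q k x = (-1)\<^sup>k P k (1 - x)\<close> they can be computed from
  \<open>P k\<close> on \<open>[0,1/2]\<close>, where the roots and critical points of \<open>P k\<close> are explicit.
\<close>

section \<open>Integration on the two halves of the unit interval\<close>

lemma has_integral_two_halves: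
  fixes u v :: "real \<Rightarrow> real"
  assumes "(u has_integral I) {0..1/2}" and "(v has_integral J) {1/2..1}"
  shows "((\<lambda>x. if x < 1/2 then u x else v x) has_integral (I + J)) {0..1}"
proof (rule has_integral_combine[of 0 "1/2" 1])
  show "((\<lambda>x. if x < 1/2 then u x else v x) has_integral I) {0..1/2}"
    by (rule has_integral_spike_finite[OF _ _ assms(1), of "{1/2}"]) auto
  show "((\<lambda>x. if x < 1/2 then u x else v x) has_integral J) {1/2..1}"
    by (rule has_integral_eq[OF _ assms(2)]) auto
qed auto

lemma has_integral_reflect_half:
  fixes h :: "real \<Rightarrow> real"
  assumes "(h has_integral I) {0..1/2}"
  shows "((\<lambda>x. h (1 - x)) has_integral I) {1/2..1}"
proof -
  have "(h has_integral I) (cbox 0 (1/2))"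
    using assms by simp
  from has_integral_affinity[OF this, of "-1" 1]
  have "((\<lambda>x. h (1 - x)) has_integral I) ((\<lambda>x. 1 - x) ` {0..1/2})"
    by simp
  then show ?thesis
    by simp
qed

lemma integral_by_parts_within:
  fixes p p' g g' :: "real \<Rightarrow> real"
  assumes "a \<le> b"
    and p: "\<And>x. x \<in> {a..b} \<Longrightarrow> (p has_real_derivative p' x) (at x within {a..b})"
    and g: "\<And>x. x \<in> {a..b} \<Longrightarrow> (g has_real_derivative g' x) (at x within {a..b})"
    and p': "continuous_on {a..b} p'"
  shows "((\<lambda>x. p x * g' x) has_integral
           (p b * g b - p a * g a - integral {a..b} (\<lambda>x. p' x * g x))) {a..b}"
proof -
  have "((\<lambda>x. p x * g' x + p' x * g x) has_integral (p b * g b - p a * g a)) {a..b}"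
  proof (rule fundamental_theorem_of_calculus[OF \<open>a \<le> b\<close>])
    fix x assume "x \<in> {a..b}"
    from DERIV_mult'[OF p[OF this] g[OF this]]
    show "((\<lambda>x. p x * g x) has_vector_derivative (p x * g' x + p' x * g x)) (at x within {a..b})"
      by (simp only: has_real_derivative_iff_has_vector_derivative)
  qed
  moreover have "((\<lambda>x. p' x * g x) has_integral integral {a..b} (\<lambda>x. p' x * g x)) {a..b}"
    by (intro integrable_integral integrable_continuous_real continuous_on_mult p'
              DERIV_continuous_on[OF g])
  ultimately have "((\<lambda>x. (p x * g' x + p' x * g x) - p' x * g x) has_integral
      (p b * g b - p a * g a - integral {a..b} (\<lambda>x. p' x * g x))) {a..b}"
    by (rule has_integral_diff)
  then show ?thesis by simp
qed

text \<open>
  A kernel given by different formulas on the two halves of the interval contributes, besides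
  the boundary terms at the end points, its jump at the midpoint.
\<close>

lemma integral_by_parts_two_halves:
  fixes p p' q q' g g' :: "real \<Rightarrow> real"
  assumes p: "\<And>x. (p has_real_derivative p' x) (at x)"
    and q: "\<And>x. (q has_real_derivative q' x) (at x)"
    and p': "continuous_on UNIV p'" and q': "continuous_on UNIV q'"
    and g: "\<And>x. x \<in> {0..1} \<Longrightarrow> (g has_real_derivative g' x) (at x within {0..1})"
  shows "integral {0..1} (\<lambda>x. (if x < 1/2 then p x else q x) * g' x) =
           q 1 * g 1 - p 0 * g 0 + (p (1/2) - q (1/2)) * g (1/2)
           - integral {0..1} (\<lambda>x. (if x < 1/2 then p' x else q' x) * g x)"
proof -
  have g0: "(g has_real_derivative g' x) (at x within {0..1/2})" if "x \<in> {0..1/2}" for x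
    using that by (intro DERIV_subset[OF g]) auto
  have g1: "(g has_real_derivative g' x) (at x within {1/2..1})" if "x \<in> {1/2..1}" for x
    using that by (intro DERIV_subset[OF g]) auto
  let ?I = "integral {0..1/2} (\<lambda>x. p' x * g x)" and ?J = "integral {1/2..1} (\<lambda>x. q' x * g x)"
  have "((\<lambda>x. if x < 1/2 then p x * g' x else q x * g' x) has_integral
      ((p (1/2) * g (1/2) - p 0 * g 0 - ?I) + (q 1 * g 1 - q (1/2) * g (1/2) - ?J))) {0..1}"
    by (intro has_integral_two_halves integral_by_parts_within g0 g1
          has_field_derivative_at_within[OF p] has_field_derivative_at_within[OF q]
          continuous_on_subset[OF p'] continuous_on_subset[OF q']) auto
  moreover have "((\<lambda>x. if x < 1/2 then p' x * g x else q' x * g x) has_integral (?I + ?J)) {0..1}"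
    by (intro has_integral_two_halves integrable_integral integrable_continuous_real
          continuous_on_mult continuous_on_subset[OF p'] continuous_on_subset[OF q']
          DERIV_continuous_on[OF g0] DERIV_continuous_on[OF g1]) auto
  moreover have "(if c then y else z) * w = (if c then y * w else z * w)" for c and y z w :: real
    by simp
  ultimately show ?thesis
    by (simp only: has_integral_iff) (simp add: left_diff_distrib)
qed

section \<open>The kernels\<close>

lemma P_has_derivative:
  assumes "k \<in> {2, 3, 4}"
  shows "(P (Suc k) has_real_derivative P k x) (at x)"
proof -
  have "((\<lambda>y. P (Suc k) y) has_real_derivative P k x) (at x)"
    using assms unfolding P_def
    by (elim insertE emptyE; simp add: fact_numeral)
       (auto intro!: derivative_eq_intros simp: field_simps power2_eq_square power3_eq_cube)
  then show ?thesis by simp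
qed

lemma Q_has_derivative:
  assumes "k \<in> {2, 3, 4}"
  shows "(Q (Suc k) has_real_derivative Q k x) (at x)"
proof -
  have "((\<lambda>y. Q (Suc k) y) has_real_derivative Q k x) (at x)"
    using assms unfolding Q_def
    by (elim insertE emptyE; simp add: fact_numeral)
       (auto intro!: derivative_eq_intros simp: field_simps power2_eq_square power3_eq_cube)
  then show ?thesis by simp
qed

lemma continuous_on_P [continuous_intros]: "continuous_on A (P k)"
  unfolding P_def by (cases "k = 2"; cases "k = 3"; cases "k = 4"; cases "k = 5"; simp)
    (auto intro!: continuous_intros)

lemma continuous_on_Q [continuous_intros]: "continuous_on A (Q k)"
  unfolding Q_def by (cases "k = 2"; cases "k = 3"; cases "k = 4"; cases "k = 5"; simp)
    (auto intro!: continuous_intros)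

lemma Q_reflect: "Q k x = (-1) ^ k * P k (1 - x)"
  unfolding P_def Q_def
  by (auto simp: fact_numeral field_simps eval_nat_numeral)

lemma P_half_eq_Q_half: "P k (1/2) = Q k (1/2)"
  by (auto simp: P_def Q_def fact_numeral power2_eq_square)

lemma continuous_on_T: "continuous_on {0..1} (T k)"
proof -
  have "continuous_on {0..1} (\<lambda>x. if x \<le> 1/2 then (-1) ^ k * P k x else (-1) ^ k * Q k x)"
  proof (rule continuous_on_cases_le)
    show "\<And>x. x \<in> {0..1} \<Longrightarrow> x = 1/2 \<Longrightarrow> (-1) ^ k * P k x = (-1) ^ k * Q k x"
      by (simp only: P_half_eq_Q_half)
  qed (intro continuous_intros)+
  moreover have "T k = (\<lambda>x. if x \<le> 1/2 then (-1) ^ k * P k x else (-1) ^ k * Q k x)"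
  proof
    fix x
    show "T k x = (if x \<le> 1/2 then (-1) ^ k * P k x else (-1) ^ k * Q k x)"
    proof (cases "x = 1/2")
      case True
      show ?thesis unfolding True by (simp add: T_def P_half_eq_Q_half)
    qed (simp add: T_def)
  qed
  ultimately show ?thesis by simp
qed

lemma has_integral_T:
  assumes "(P k has_integral I) {0..1/2}"
  shows "(T k has_integral ((-1) ^ k + 1) * I) {0..1}"
proof -
  have "((\<lambda>x. if x < 1/2 then (-1) ^ k * P k x else P k (1 - x)) has_integral (-1) ^ k * I + I) {0..1}"
    by (intro has_integral_two_halves has_integral_mult_right has_integral_reflect_half assms)
  moreover have "T k = (\<lambda>x. if x < 1/2 then (-1) ^ k * P k x else P k (1 - x))"
    by (rule ext) (simp add: T_def Q_reflect flip: power_mult_distrib mult.assoc)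
  ultimately show ?thesis by (simp add: algebra_simps)
qed

lemma abs_T: "\<bar>T k x\<bar> = (if x < 1/2 then \<bar>P k x\<bar> else \<bar>P k (1 - x)\<bar>)"
  by (simp add: T_def Q_reflect abs_mult power_abs)

lemma has_integral_abs_T:
  assumes "((\<lambda>x. \<bar>P k x\<bar>) has_integral I) {0..1/2}"
  shows "((\<lambda>x. \<bar>T k x\<bar>) has_integral 2 * I) {0..1}"
  using has_integral_two_halves[OF assms has_integral_reflect_half[OF assms]]
  by (simp add: abs_T)

text \<open>
  For odd \<open>k\<close> the kernel is antisymmetric about \<open>1/2\<close>. For even \<open>k\<close> the two halves
  contribute equally, and each contribution is \<open>0\<close> because the antiderivative \<open>P (k + 1)\<close>
  vanishes at both \<open>0\<close> and \<open>1/2\<close>.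
\<close>

lemma integral_T_eq_0:
  assumes "k \<in> {2, 3, 4, 5}"
  shows "integral {0..1} (T k) = 0"
proof -
  have int: "(P k has_integral integral {0..1/2} (P k)) {0..1/2}"
    by (intro integrable_integral integrable_continuous_real continuous_intros)
  have "integral {0..1} (T k) = ((-1) ^ k + 1) * integral {0..1/2} (P k)"
    using has_integral_T[OF int] by (rule integral_unique)
  moreover have "integral {0..1/2} (P k) = 0" if "k \<in> {2, 4}"
  proof -
    have "(P k has_integral (P (Suc k) (1/2) - P (Suc k) 0)) {0..1/2}"
      using that
      by (intro fundamental_theorem_of_calculus)
         (auto simp flip: has_real_derivative_iff_has_vector_derivative
               intro!: has_field_derivative_at_within P_has_derivative)
    moreover have "P (Suc k) (1/2) = 0" "P (Suc k) 0 = 0"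
      using that by (auto simp: P_def)
    ultimately show ?thesis by (simp add: has_integral_iff)
  qed
  ultimately show ?thesis using assms by auto
qed

section \<open>The norms of the kernels\<close>

lemma has_integral_abs_of_constant_sign:
  fixes F h :: "real \<Rightarrow> real"
  assumes "a \<le> b"
    and F: "\<And>x. (F has_real_derivative h x) (at x)"
    and sign: "(\<forall>x\<in>{a..b}. 0 \<le> h x) \<or> (\<forall>x\<in>{a..b}. h x \<le> 0)"
  shows "((\<lambda>x. \<bar>h x\<bar>) has_integral \<bar>F b - F a\<bar>) {a..b}"
proof -
  have I: "(h has_integral (F b - F a)) {a..b}"
    by (intro fundamental_theorem_of_calculus \<open>a \<le> b\<close>)
       (auto simp flip: has_real_derivative_iff_has_vector_derivative
             intro!: has_field_derivative_at_within F)
  from sign show ?thesis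
  proof
    assume pos: "\<forall>x\<in>{a..b}. 0 \<le> h x"
    have "((\<lambda>x. \<bar>h x\<bar>) has_integral (F b - F a)) {a..b}"
      by (rule has_integral_eq[OF _ I]) (use pos in simp)
    moreover from this have "0 \<le> F b - F a"
      by (rule has_integral_nonneg) simp
    ultimately show ?thesis by simp
  next
    assume neg: "\<forall>x\<in>{a..b}. h x \<le> 0"
    have "((\<lambda>x. \<bar>h x\<bar>) has_integral - (F b - F a)) {a..b}"
      by (rule has_integral_eq[OF _ has_integral_neg[OF I]]) (use neg in simp)
    moreover from this have "0 \<le> - (F b - F a)"
      by (rule has_integral_nonneg) simp
    ultimately show ?thesis by simp
  qed
qed

text \<open>
  The critical points of \<open>P 3\<close> are the roots \<open>(7 \<plusminus> \<surd>19) / 30\<close> of \<open>P 2\<close>. Subtracting its local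
  extreme value leaves a double root at such a point. The third root is determined by the sum
  \<open>7/10\<close> of the three roots, and it lies outside \<open>(0,1/2)\<close>, so the sign on \<open>[0,1/2]\<close>
  can be read off. The factorizations also provide the values of \<open>P 3\<close> at its critical points.
\<close>

lemma P_3_above_minimum:
  "P 3 x + (7/20250 + 19 * sqrt 19 / 81000) = 1/6 * (x - (7 + sqrt 19)/30)^2 * (x - (7 - 2 * sqrt 19)/30)"
proof -
  define s where "s = sqrt 19"
  have ss: "s * s = 19" "s * (s * y) = 19 * y" for y
    by (simp_all add: s_def flip: mult.assoc)
  have "P 3 x + (7/20250 + 19 * s / 81000) = 1/6 * (x - (7 + s)/30)^2 * (x - (7 - 2 * s)/30)"
    unfolding P_def by (simp add: fact_numeral power2_eq_square field_simps) (simp add: ss)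
  then show ?thesis by (simp add: s_def)
qed

lemma P_3_below_maximum:
  "(19 * sqrt 19 / 81000 - 7/20250) - P 3 x = 1/6 * (x - (7 - sqrt 19)/30)^2 * ((7 + 2 * sqrt 19)/30 - x)"
proof -
  define s where "s = sqrt 19"
  have ss: "s * s = 19" "s * (s * y) = 19 * y" for y
    by (simp_all add: s_def flip: mult.assoc)
  have "(19 * s / 81000 - 7/20250) - P 3 x = 1/6 * (x - (7 - s)/30)^2 * ((7 + 2 * s)/30 - x)"
    unfolding P_def by (simp add: fact_numeral power2_eq_square field_simps) (simp add: ss)
  then show ?thesis by (simp add: s_def)
qed

lemma sqrt_19_bounds: "4 < sqrt 19" "sqrt 19 < 5"
  by (auto intro: real_less_rsqrt real_less_lsqrt)

lemma P_2_factor: "P 2 x = 1/2 * (x - (7 - sqrt 19)/30) * (x - (7 + sqrt 19)/30)"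
proof -
  define s where "s = sqrt 19"
  have ss: "s * s = 19" "s * (s * y) = 19 * y" for y
    by (simp_all add: s_def flip: mult.assoc)
  have "P 2 x = 1/2 * (x - (7 - s)/30) * (x - (7 + s)/30)"
    unfolding P_def by (simp add: power2_eq_square field_simps) (simp add: ss)
  then show ?thesis by (simp add: s_def)
qed

text \<open>
  In this and the next two lemmas, \<open>[0,1/2]\<close> is cut at the sign changes of \<open>P k\<close>, and
  \<open>P (k + 1)\<close> is evaluated at the cuts.
\<close>

lemma has_integral_abs_P_2: "((\<lambda>x. \<bar>P 2 x\<bar>) has_integral C_const 2 / 2) {0..1/2}"
proof -
  define a b where "a = (7 - sqrt 19)/30" and "b = (7 + sqrt 19)/30"
  have ord: "0 \<le> a" "a \<le> b" "b \<le> 1/2"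
    using sqrt_19_bounds by (auto simp: a_def b_def)
  have fac: "P 2 x = 1/2 * ((x - a) * (x - b))" for x
    using P_2_factor[of x] by (simp add: a_def b_def)
  have D: "(P 3 has_real_derivative P 2 x) (at x)" for x
    using P_has_derivative[of 2 x] by simp
  have "((\<lambda>x. \<bar>P 2 x\<bar>) has_integral \<bar>P 3 a - P 3 0\<bar>) {0..a}"
    using ord by (intro has_integral_abs_of_constant_sign D disjI1)
      (auto simp: fac intro!: mult_nonpos_nonpos)
  moreover have "((\<lambda>x. \<bar>P 2 x\<bar>) has_integral \<bar>P 3 b - P 3 a\<bar>) {a..b}"
    using ord by (intro has_integral_abs_of_constant_sign D disjI2)
      (auto simp: fac intro!: mult_nonneg_nonpos)
  moreover have "((\<lambda>x. \<bar>P 2 x\<bar>) has_integral \<bar>P 3 (1/2) - P 3 b\<bar>) {b..1/2}"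
    using ord by (intro has_integral_abs_of_constant_sign D disjI1)
      (auto simp: fac)
  ultimately have "((\<lambda>x. \<bar>P 2 x\<bar>) has_integral
      (\<bar>P 3 a - P 3 0\<bar> + \<bar>P 3 b - P 3 a\<bar> + \<bar>P 3 (1/2) - P 3 b\<bar>)) {0..1/2}"
    using ord by (meson has_integral_combine order_trans)
  moreover have "P 3 0 = 0" "P 3 (1/2) = 0"
    by (simp_all add: P_def)
  moreover have "P 3 a = 19 * sqrt 19 / 81000 - 7/20250"
    using P_3_below_maximum[of a] by (simp add: a_def)
  moreover have "P 3 b = - (7/20250 + 19 * sqrt 19 / 81000)"
    using P_3_above_minimum[of b] by (simp add: b_def)
  ultimately show ?thesis
    using sqrt_19_bounds by (simp add: C_const_def)
qed

lemma has_integral_abs_P_3: "((\<lambda>x. \<bar>P 3 x\<bar>) has_integral C_const 3 / 2) {0..1/2}"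
proof -
  have D: "(P 4 has_real_derivative P 3 x) (at x)" for x
    using P_has_derivative[of 3 x] by simp
  have fac: "P 3 x = 1/6 * (x * ((x - 1/5) * (x - 1/2)))" for x
    by (simp add: P_def fact_numeral)
  have "((\<lambda>x. \<bar>P 3 x\<bar>) has_integral \<bar>P 4 (1/5) - P 4 0\<bar>) {0..1/5}"
    by (intro has_integral_abs_of_constant_sign D disjI1 ballI)
      (simp_all add: fac zero_le_mult_iff)
  moreover have "((\<lambda>x. \<bar>P 3 x\<bar>) has_integral \<bar>P 4 (1/2) - P 4 (1/5)\<bar>) {1/5..1/2}"
    by (intro has_integral_abs_of_constant_sign D disjI2)
      (auto simp: fac intro!: mult_nonneg_nonpos)
  ultimately have "((\<lambda>x. \<bar>P 3 x\<bar>) has_integral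
      (\<bar>P 4 (1/5) - P 4 0\<bar> + \<bar>P 4 (1/2) - P 4 (1/5)\<bar>)) {0..1/2}"
    by (intro has_integral_combine[of 0 "1/5" "1/2"]) auto
  then show ?thesis
    by (simp add: P_def C_const_def fact_numeral power2_eq_square)
qed

lemma has_integral_abs_P_4: "((\<lambda>x. \<bar>P 4 x\<bar>) has_integral C_const 4 / 2) {0..1/2}"
proof -
  have D: "(P 5 has_real_derivative P 4 x) (at x)" for x
    using P_has_derivative[of 4 x] by simp
  have fac: "P 4 x = 1/24 * (x^2 * ((x - 1/3) * (x - 3/5)))" for x
    by (simp add: P_def fact_numeral)
  have "((\<lambda>x. \<bar>P 4 x\<bar>) has_integral \<bar>P 5 (1/3) - P 5 0\<bar>) {0..1/3}"
    by (intro has_integral_abs_of_constant_sign D disjI1 ballI)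
      (simp_all add: fac zero_le_mult_iff)
  moreover have "((\<lambda>x. \<bar>P 4 x\<bar>) has_integral \<bar>P 5 (1/2) - P 5 (1/3)\<bar>) {1/3..1/2}"
    by (intro has_integral_abs_of_constant_sign D disjI2)
      (auto simp: fac intro!: mult_nonneg_nonpos)
  ultimately have "((\<lambda>x. \<bar>P 4 x\<bar>) has_integral
      (\<bar>P 5 (1/3) - P 5 0\<bar> + \<bar>P 5 (1/2) - P 5 (1/3)\<bar>)) {0..1/2}"
    by (intro has_integral_combine[of 0 "1/3" "1/2"]) auto
  then show ?thesis
    by (simp add: P_def C_const_def fact_numeral power3_eq_cube)
qed

lemma P_5_nonneg: "x \<in> {0..1/2} \<Longrightarrow> 0 \<le> P 5 x"
proof -
  assume "x \<in> {0..1/2}"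
  then have "0 \<le> 1/120 * (x^3 * ((x - 1/2) * (x - 2/3)))"
    by (intro mult_nonneg_nonneg mult_nonpos_nonpos) auto
  then show ?thesis by (simp add: P_def fact_numeral mult.assoc)
qed

lemma has_integral_abs_P_5: "((\<lambda>x. \<bar>P 5 x\<bar>) has_integral C_const 5 / 2) {0..1/2}"
proof -
  \<comment> \<open>The next member of the sequence of kernels, the antiderivative of \<open>P 5\<close> with value \<open>0\<close> at \<open>0\<close>.\<close>
  define F :: "real \<Rightarrow> real" where "F x = (x^6 / 6 - 7/30 * x^5 + x^4 / 12) / 120" for x
  have D: "(F has_real_derivative P 5 x) (at x)" for x
    unfolding F_def P_def
    by (auto intro!: derivative_eq_intros simp: fact_numeral field_simps eval_nat_numeral)
  have "((\<lambda>x. \<bar>P 5 x\<bar>) has_integral \<bar>F (1/2) - F 0\<bar>) {0..1/2}"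
    by (intro has_integral_abs_of_constant_sign D disjI1) (auto intro: P_5_nonneg)
  then show ?thesis
    by (simp add: F_def C_const_def power_divide)
qed

lemma integral_abs_T:
  assumes "k \<in> {2, 3, 4, 5}"
  shows "integral {0..1} (\<lambda>x. \<bar>T k x\<bar>) = C_const k"
proof -
  have "((\<lambda>x. \<bar>P k x\<bar>) has_integral C_const k / 2) {0..1/2}"
    using assms has_integral_abs_P_2 has_integral_abs_P_3 has_integral_abs_P_4 has_integral_abs_P_5
    by auto
  from has_integral_abs_T[OF this] show ?thesis by (simp add: has_integral_iff)
qed

lemma abs_P_2_le:
  assumes "x \<in> {0..1/2}"
  shows "\<bar>P 2 x\<bar> \<le> 1/40"
proof (rule abs_leI)
  have "1/40 - P 2 x = 1/2 * ((1/2 - x) * (x + 1/30))"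
    by (simp add: P_def power2_eq_square field_simps)
  also have "\<dots> \<ge> 0" using assms by auto
  finally show "P 2 x \<le> 1/40" by simp
  have "1/40 + P 2 x = 1/2 * (x - 7/30)^2 + 13/900"
    by (simp add: P_def power2_eq_square field_simps)
  also have "\<dots> \<ge> 0" by simp
  finally show "- P 2 x \<le> 1/40" by simp
qed

lemma abs_P_3_le:
  assumes "x \<in> {0..1/2}"
  shows "\<bar>P 3 x\<bar> \<le> 7/20250 + 19 * sqrt 19 / 81000"
proof (rule abs_leI)
  have "0 \<le> 1/6 * (x - (7 - sqrt 19)/30)^2 * ((7 + 2 * sqrt 19)/30 - x)"
    using assms sqrt_19_bounds by (intro mult_nonneg_nonneg) auto
  then show "P 3 x \<le> 7/20250 + 19 * sqrt 19 / 81000"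
    using P_3_below_maximum[of x] by linarith
  have "0 \<le> 1/6 * (x - (7 + sqrt 19)/30)^2 * (x - (7 - 2 * sqrt 19)/30)"
    using assms sqrt_19_bounds by (intro mult_nonneg_nonneg) auto
  then show "- P 3 x \<le> 7/20250 + 19 * sqrt 19 / 81000"
    using P_3_above_minimum[of x] by linarith
qed

lemma abs_P_4_le:
  assumes "x \<in> {0..1/2}"
  shows "\<bar>P 4 x\<bar> \<le> 1/5760"
proof (rule abs_leI)
  \<comment> \<open>The local maximum at \<open>1/5\<close> is smaller than \<open>1/5760\<close>, so a crude estimate suffices:
      on \<open>[0,1/3]\<close> both quadratic factors are replaced by their maxima.\<close>
  have "(x * (1/3 - x)) * (x * (3/5 - x)) \<le> 1/36 * (9/100)"
  proof (cases "x \<le> 1/3")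
    case True
    have "x * (1/3 - x) = 1/36 - (x - 1/6)^2" "x * (3/5 - x) = 9/100 - (x - 3/10)^2"
      by (simp_all add: power2_eq_square field_simps)
    then have "x * (1/3 - x) \<le> 1/36" "x * (3/5 - x) \<le> 9/100"
      by simp_all
    then show ?thesis using assms True by (intro mult_mono) auto
  next
    case False
    then have "(x * (1/3 - x)) * (x * (3/5 - x)) \<le> 0"
      using assms by (intro mult_nonpos_nonneg mult_nonneg_nonpos mult_nonneg_nonneg) auto
    then show ?thesis by simp
  qed
  then show "P 4 x \<le> 1/5760"
    by (simp add: P_def fact_numeral power2_eq_square field_simps)
  \<comment> \<open>The minimum of \<open>P 4\<close> on \<open>[0,1/2]\<close> is attained at the end point \<open>1/2\<close>, hence the factor \<open>1/2 - x\<close>.\<close>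
  have "P 4 x + 1/5760 = 1/24 * ((1/2 - x) * (1/120 + x/60 - x * (x * (x - 13/30))))"
    by (simp add: P_def fact_numeral power2_eq_square field_simps)
  also have "x * (x * (x - 13/30)) \<le> x * (1/30)"
  proof (rule mult_left_mono)
    have "1/30 - x * (x - 13/30) = (1/2 - x) * (x + 1/15)"
      by (simp add: field_simps)
    also have "\<dots> \<ge> 0" using assms by auto
    finally show "x * (x - 13/30) \<le> 1/30" by simp
  qed (use assms in auto)
  then have "0 \<le> 1/24 * ((1/2 - x) * (1/120 + x/60 - x * (x * (x - 13/30))))"
    using assms by (intro mult_nonneg_nonneg) auto
  finally show "- P 4 x \<le> 1/5760" by simp
qed

lemma abs_P_5_le:
  assumes "x \<in> {0..1/2}"
  shows "\<bar>P 5 x\<bar> \<le> 1/58320"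
proof -
  \<comment> \<open>The maximum is attained at the root \<open>1/3\<close> of \<open>P 4\<close>, hence the double root there.\<close>
  have "1/58320 - P 5 x = 1/120 * ((x - 1/3)^2 * (x^2 * (1/2 - x) + x/9 + 1/54))"
    by (simp add: P_def fact_numeral field_simps eval_nat_numeral)
  also have "\<dots> \<ge> 0"
    using assms by (intro mult_nonneg_nonneg add_nonneg_nonneg) auto
  finally show ?thesis using P_5_nonneg[OF assms] by simp
qed

lemma abs_T_le:
  assumes "k \<in> {2, 3, 4, 5}" and "x \<in> {0..1}"
  shows "\<bar>T k x\<bar> \<le> B_const k"
proof -
  have "\<bar>P k y\<bar> \<le> B_const k" if "y \<in> {0..1/2}" for y
    using assms(1) that abs_P_2_le abs_P_3_le abs_P_4_le abs_P_5_le
    unfolding B_const_def by auto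
  then show ?thesis using assms(2) by (simp add: abs_T)
qed

section \<open>The quadrature formula\<close>

lemma D01_has_derivative:
  assumes "C_diff_on k f {0..1}" and "i < k" and "x \<in> {0..1}"
  shows "(D01 i f has_real_derivative D01 (Suc i) f x) (at x within {0..1})"
  using assms
  by (auto simp: C_diff_on_def differentiable_on_def vector_derivative_works
                 has_real_derivative_iff_has_vector_derivative)

text \<open>
  Passing from \<open>T (k + 1)\<close> to \<open>T k\<close> changes the sign \<open>(-1)\<^sup>k\<close>, which compensates the minus
  sign of the integration by parts.
\<close>

lemma R_Suc:
  assumes "k \<in> {2, 3, 4}" and f: "C_diff_on (Suc k) f {0..1}"
  shows "R (Suc k) f = R k f"
proof -
  have ends: "P (Suc k) 0 = 0" "Q (Suc k) 1 = 0"
    using assms(1) by (auto simp: P_def Q_def)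
  have "R (Suc k) f = (-1)^Suc k * Q (Suc k) 1 * D01 k f 1 - (-1)^Suc k * P (Suc k) 0 * D01 k f 0
      + ((-1)^Suc k * P (Suc k) (1/2) - (-1)^Suc k * Q (Suc k) (1/2)) * D01 k f (1/2)
      - integral {0..1} (\<lambda>x. (if x < 1/2 then (-1)^Suc k * P k x else (-1)^Suc k * Q k x) * D01 k f x)"
    unfolding R_def T_def
    by (intro integral_by_parts_two_halves DERIV_cmult P_has_derivative Q_has_derivative
          continuous_intros D01_has_derivative[OF f] assms(1)) auto
  also have "\<dots> = - integral {0..1} (\<lambda>x. - (T k x * D01 k f x))"
    by (simp add: T_def ends P_half_eq_Q_half if_distrib[where f = "\<lambda>y. y * _"] if_distrib[where f = uminus]
        cong: if_cong)
  also have "\<dots> = R k f"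
    by (simp add: R_def)
  finally show ?thesis .
qed

lemma R_2:
  assumes f: "C_diff_on 2 f {0..1}"
  shows "R 2 f = integral {0..1} f - (7 * f 0 + 16 * f (1/2) + 7 * f 1) / 30
           + (D01 1 f 1 - D01 1 f 0) / 60"
proof -
  have f1: "(f has_real_derivative D01 1 f x) (at x within {0..1})" if "x \<in> {0..1}" for x
    using D01_has_derivative[OF f _ that, of 0] by simp
  have f2: "(D01 1 f has_real_derivative D01 2 f x) (at x within {0..1})" if "x \<in> {0..1}" for x
    using D01_has_derivative[OF f _ that, of 1] by (simp add: numeral_2_eq_2)
  have D: "(P 2 has_real_derivative x - 7/30) (at x)" "(Q 2 has_real_derivative x - 23/30) (at x)" for x
    unfolding P_def Q_def by (auto intro!: derivative_eq_intros)
  have "R 2 f = Q 2 1 * D01 1 f 1 - P 2 0 * D01 1 f 0 + (P 2 (1/2) - Q 2 (1/2)) * D01 1 f (1/2)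
      - integral {0..1} (\<lambda>x. (if x < 1/2 then x - 7/30 else x - 23/30) * D01 1 f x)"
    unfolding R_def T_def power2_minus power_one mult_1
    by (intro integral_by_parts_two_halves D f2 continuous_intros)
  also have "integral {0..1} (\<lambda>x. (if x < 1/2 then x - 7/30 else x - 23/30) * D01 1 f x)
      = (1 - 23/30) * f 1 - (0 - 7/30) * f 0 + ((1/2 - 7/30) - (1/2 - 23/30)) * f (1/2)
        - integral {0..1} (\<lambda>x. (if x < 1/2 then 1 else 1) * f x)"
    by (intro integral_by_parts_two_halves f1 continuous_intros) (auto intro!: derivative_eq_intros)
  finally show ?thesis
    by (simp add: P_half_eq_Q_half) (simp add: P_def Q_def field_simps)
qed

lemma R_eq_quadrature_error:
  assumes "k \<in> {2, 3, 4, 5}" and f: "C_diff_on k f {0..1}"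
  shows "R k f = integral {0..1} f - (7 * f 0 + 16 * f (1/2) + 7 * f 1) / 30
           + (D01 1 f 1 - D01 1 f 0) / 60"
proof -
  have diff: "C_diff_on j f {0..1}" if "j \<le> k" for j
  proof (cases "j = k")
    case False
    with that f have "D01 j f differentiable_on {0..1}" by (simp add: C_diff_on_def)
    with f that show ?thesis
      by (auto simp: C_diff_on_def differentiable_imp_continuous_on)
  qed (use f in simp)
  have "j \<le> k \<longrightarrow> R j f = R 2 f" if "2 \<le> j" for j
    using that
  proof (induction j rule: dec_induct)
    case (step j)
    then show ?case using assms(1) diff R_Suc[of j f] by fastforce
  qed simp
  then show ?thesis using assms(1) R_2[OF diff[of 2]] by auto
qed

section \<open>Estimates for mean-zero kernels\<close>

lemma mean_zero_kernel_bounds: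
  fixes K g :: "real \<Rightarrow> real"
  assumes K: "continuous_on {a..b} K" and g: "continuous_on {a..b} g"
    and mean: "integral {a..b} K = 0"
    and bound: "\<And>x. x \<in> {a..b} \<Longrightarrow> \<bar>K x\<bar> \<le> B"
    and g_bounds: "\<And>x. x \<in> {a..b} \<Longrightarrow> l \<le> g x \<and> g x \<le> u"
    and "a \<le> b"
  shows "\<bar>integral {a..b} (\<lambda>x. K x * g x)\<bar> \<le> (u - l) / 2 * integral {a..b} (\<lambda>x. \<bar>K x\<bar>)"
    and "\<bar>integral {a..b} (\<lambda>x. K x * g x)\<bar> \<le> (integral {a..b} g - l * (b - a)) * B"
    and "\<bar>integral {a..b} (\<lambda>x. K x * g x)\<bar> \<le> (u * (b - a) - integral {a..b} g) * B"
proof -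
  \<comment> \<open>Since \<open>K\<close> has mean zero, any constant may be subtracted from \<open>g\<close>.\<close>
  have shift: "integral {a..b} (\<lambda>x. K x * g x) = integral {a..b} (\<lambda>x. K x * (g x - c))" for c
  proof -
    have "integral {a..b} (\<lambda>x. K x * g x - K x * c) = integral {a..b} (\<lambda>x. K x * g x) - integral {a..b} (\<lambda>x. K x * c)"
      by (intro Henstock_Kurzweil_Integration.integral_diff integrable_continuous_real continuous_intros K g)
    then show ?thesis by (simp add: mean right_diff_distrib)
  qed
  have dominated: "\<bar>integral {a..b} (\<lambda>x. K x * g x)\<bar> \<le> integral {a..b} h"
    if "continuous_on {a..b} h" "\<And>x. x \<in> {a..b} \<Longrightarrow> \<bar>K x * (g x - c)\<bar> \<le> h x" for h c
    unfolding shift[of c] using that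
    by (intro integral_norm_bound_integral[where 'a = real, unfolded real_norm_def]
          integrable_continuous_real continuous_intros K g) auto
  have "\<bar>integral {a..b} (\<lambda>x. K x * g x)\<bar> \<le> integral {a..b} (\<lambda>x. (u - l) / 2 * \<bar>K x\<bar>)"
  proof (rule dominated[where c = "(u + l) / 2"])
    fix x assume "x \<in> {a..b}"
    then have "\<bar>g x - (u + l) / 2\<bar> \<le> (u - l) / 2"
      using g_bounds[of x] by (auto simp: abs_le_iff field_simps)
    then have "\<bar>K x\<bar> * \<bar>g x - (u + l) / 2\<bar> \<le> \<bar>K x\<bar> * ((u - l) / 2)"
      by (rule mult_left_mono) simp
    then show "\<bar>K x * (g x - (u + l) / 2)\<bar> \<le> (u - l) / 2 * \<bar>K x\<bar>"
      by (simp only: abs_mult mult.commute)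
  qed (intro continuous_intros K)
  then show "\<bar>integral {a..b} (\<lambda>x. K x * g x)\<bar> \<le> (u - l) / 2 * integral {a..b} (\<lambda>x. \<bar>K x\<bar>)"
    by simp
  have "\<bar>integral {a..b} (\<lambda>x. K x * g x)\<bar> \<le> integral {a..b} (\<lambda>x. (g x - l) * B)"
  proof (rule dominated[where c = l])
    fix x assume "x \<in> {a..b}"
    then show "\<bar>K x * (g x - l)\<bar> \<le> (g x - l) * B"
      using g_bounds[of x] bound[of x] by (auto simp: abs_mult mult.commute intro: mult_right_mono)
  qed (intro continuous_intros g)
  also have "\<dots> = (integral {a..b} g - l * (b - a)) * B"
    using g \<open>a \<le> b\<close> by (simp add: Henstock_Kurzweil_Integration.integral_diff integrable_continuous_real)
  finally show "\<bar>integral {a..b} (\<lambda>x. K x * g x)\<bar> \<le> (integral {a..b} g - l * (b - a)) * B" .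
  have "\<bar>integral {a..b} (\<lambda>x. K x * g x)\<bar> \<le> integral {a..b} (\<lambda>x. (u - g x) * B)"
  proof (rule dominated[where c = u])
    fix x assume "x \<in> {a..b}"
    then show "\<bar>K x * (g x - u)\<bar> \<le> (u - g x) * B"
      using g_bounds[of x] bound[of x] by (auto simp: abs_mult mult.commute intro: mult_right_mono)
  qed (intro continuous_intros g)
  also have "\<dots> = (u * (b - a) - integral {a..b} g) * B"
    using g \<open>a \<le> b\<close> by (simp add: Henstock_Kurzweil_Integration.integral_diff integrable_continuous_real)
  finally show "\<bar>integral {a..b} (\<lambda>x. K x * g x)\<bar> \<le> (u * (b - a) - integral {a..b} g) * B" .
qed

section \<open>The error estimates\<close>

theorem theorem3:
  fixes f :: "real \<Rightarrow> real" and k :: nat and \<gamma> \<Gamma> :: real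
  assumes "k \<in> {2, 3, 4, 5}"
    and "C_diff_on k f {0..1}"
    and "\<And>x. x \<in> {0..1} \<Longrightarrow> \<gamma> \<le> D01 k f x \<and> D01 k f x \<le> \<Gamma>"
  shows "integral {0..1} f =
           (7 * f 0 + 16 * f (1/2) + 7 * f 1) / 30 - (D01 1 f 1 - D01 1 f 0) / 60 + R k f
         \<and> \<bar>R k f\<bar> \<le> (\<Gamma> - \<gamma>) / 2 * C_const k
         \<and> \<bar>R k f\<bar> \<le> (S (k - 1) f - \<gamma>) * B_const k
         \<and> \<bar>R k f\<bar> \<le> (\<Gamma> - S (k - 1) f) * B_const k"
proof -
  have "continuous_on {0..1} (D01 k f)"
    using assms(2) by (simp add: C_diff_on_def)
  note bounds = mean_zero_kernel_bounds[OF continuous_on_T this integral_T_eq_0[OF assms(1)]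
      abs_T_le[OF assms(1)] assms(3)]
  have "(D01 k f has_integral S (k - 1) f) {0..1}"
    unfolding S_def using D01_has_derivative[OF assms(2), of "k - 1"] assms(1)
    by (intro fundamental_theorem_of_calculus)
       (auto simp flip: has_real_derivative_iff_has_vector_derivative)
  then have "integral {0..1} (D01 k f) = S (k - 1) f"
    by (rule integral_unique)
  then show ?thesis
    using bounds R_eq_quadrature_error[OF assms(1,2)]
    by (simp add: integral_abs_T[OF assms(1)] R_def)
qed

end
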